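(* Let $\gamma\in(1,5/3]$, $A\in C^2(\mathbf R_+)$ with $A>0$, and $a=A'/A$. Let $\bar a\in C^1_b(\mathbf R_+)\cap L^1(\mathbf R_+)$ and positive constants $L_1,L_2,U_1,U_2$ satisfy $|a(x)|<l\,\bar a(x)$ for all $x\ge0$ and $$L_1\le U_1,\quad L_2\le U_2,\quad L_2-U_1e^{2\int_0^\infty\bar a(x)dx}>0,\quad \frac{U_2}{L_1}e^{2\int_0^\infty\bar a(x)dx}\le\sigma_2 .$$ If $(z_0(x),w_0(x))\in\Delta_{r,x}$ for every $x\ge0$, $(z_B(t),w_B(t))\in\Delta_{r,0}$ for every $t\ge0$, and (P2) has a smooth solution $(z,w)$ satisfying $\rho\ge0$, then $\Delta_{r,x}$ is an invariant region for (P2): $(z(x,t),w(x,t))\in\Delta_{r,x}$ for every $x\ge0$ and every $t\ge0$ in the time interval of existence of the solution.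
   Context: Notation: $\mathbf R_+=[0,\infty)$; $C^1_b$ denotes $C^1$ functions that are bounded together with their first derivative. $\theta=(\gamma-1)/2$. The problem comes from the isentropic nozzle flow equations $\rho_t+m_x=-a(x)m$, $m_t+(m^2/\rho+p(\rho))_x=-a(x)m^2/\rho$, $p(\rho)=\rho^\gamma/\gamma$, $v=m/\rho$, via the Riemann invariants $w=v+\rho^\theta/\theta$, $z=v-\rho^\theta/\theta$, so that $v=(w+z)/2$ and $\rho=(\theta(w-z)/2)^{1/\theta}$; thus $\rho\ge0$ means $w\ge z$. The characteristic speeds are $\lambda_1=v-\rho^\theta=\frac{\gamma+1}{4}z+\frac{3-\gamma}{4}w$ and $\lambda_2=v+\rho^\theta=\frac{3-\gamma}{4}z+\frac{\gamma+1}{4}w$. Problem (P2): on $x\ge0$, $t\ge0$, $$z_t+\lambda_1z_x=\tfrac{\gamma-1}{8}a(x)(w^2-z^2),\qquad w_t+\lambda_2w_x=-\tfrac{\gamma-1}{8}a(x)(w^2-z^2),$$ with initial data $(z,w)|_{t=0}=(z_0,w_0)$ and boundary condition $(z,w)|_{x=0}=(z_B(t),w_B(t))$. Solutions are considered in the class of bounded $C^1$ functions on $\mathbf R_+\times[0,T]$. Constants $l,\sigma_2$: let $f(r)=\frac{2}{\gamma-1}\,\frac{\gamma+1+(3-\gamma)r}{|r^2-1|}$ (with $f(\pm1)=+\infty$). $l>0$ is the minimum of $f$ on $[-1,1]$; $\sigma_2>1$ is the solution of $f(r)=l$ in $r>1$. Region: $$\Delta_{r,x}=\Big\{(z,w):L_1e^{-\int_0^x\bar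 a(y)dy}\le z\le U_1e^{\int_0^x\bar a(y)dy},\ L_2e^{-\int_0^x\bar a(y)dy}\le w\le U_2e^{\int_0^x\bar a(y)dy},\ w\ge z\Big\}.$$ *)

theory Defs
  imports "HOL-Analysis.Analysis"
begin

text \<open>
  Differentiability on the closed half-line and on the closed strip is taken relative to the
  set, i.e. one-sided at boundary points.
\<close>

primrec Ck_on :: "nat \<Rightarrow> real set \<Rightarrow> (real \<Rightarrow> real) \<Rightarrow> bool" where
  "Ck_on 0 S f \<longleftrightarrow> continuous_on S f"
| "Ck_on (Suc k) S f \<longleftrightarrow>
     (\<exists>f'. (\<forall>x\<in>S. (f has_real_derivative f' x) (at x within S)) \<and> Ck_on k S f')"

definition deriv_on :: "real set \<Rightarrow> (real \<Rightarrow> real) \<Rightarrow> real \<Rightarrow> real" where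
  "deriv_on S f x = vector_derivative f (at x within S)"

definition C1_bounded_on :: "real set \<Rightarrow> (real \<Rightarrow> real) \<Rightarrow> bool" where
  "C1_bounded_on S f \<longleftrightarrow> Ck_on 1 S f \<and> bounded (f ` S) \<and> bounded (deriv_on S f ` S)"

definition C1_with_partials_on ::
  "(real \<times> real) set \<Rightarrow> (real \<Rightarrow> real \<Rightarrow> real) \<Rightarrow> (real \<Rightarrow> real \<Rightarrow> real) \<Rightarrow> (real \<Rightarrow> real \<Rightarrow> real) \<Rightarrow> bool"
where
  "C1_with_partials_on S u ux ut \<longleftrightarrow>
     (\<forall>(x, t)\<in>S. ((\<lambda>(y, s). u y s) has_derivative (\<lambda>(h, k). ux x t * h + ut x t * k))
                   (at (x, t) within S)) \<and>
     continuous_on S (\<lambda>(x, t). ux x t) \<and> continuous_on S (\<lambda>(x, t). ut x t)"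

definition lambda1 :: "real \<Rightarrow> real \<Rightarrow> real \<Rightarrow> real" where
  "lambda1 \<gamma> z w = (\<gamma> + 1) / 4 * z + (3 - \<gamma>) / 4 * w"

definition lambda2 :: "real \<Rightarrow> real \<Rightarrow> real \<Rightarrow> real" where
  "lambda2 \<gamma> z w = (3 - \<gamma>) / 4 * z + (\<gamma> + 1) / 4 * w"

definition P2_solution ::
  "real \<Rightarrow> (real \<Rightarrow> real) \<Rightarrow> (real \<Rightarrow> real) \<Rightarrow> (real \<Rightarrow> real) \<Rightarrow> (real \<Rightarrow> real) \<Rightarrow> (real \<Rightarrow> real) \<Rightarrow>
   real \<Rightarrow> (real \<Rightarrow> real \<Rightarrow> real) \<Rightarrow> (real \<Rightarrow> real \<Rightarrow> real) \<Rightarrow> bool"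
where
  "P2_solution \<gamma> a z0 w0 zB wB T z w \<longleftrightarrow>
     bounded ((\<lambda>(x, t). z x t) ` ({0..} \<times> {0..T})) \<and>
     bounded ((\<lambda>(x, t). w x t) ` ({0..} \<times> {0..T})) \<and>
     (\<exists>zx zt wx wt.
        C1_with_partials_on ({0..} \<times> {0..T}) z zx zt \<and>
        C1_with_partials_on ({0..} \<times> {0..T}) w wx wt \<and>
        (\<forall>x\<ge>0. \<forall>t\<in>{0..T}.
           zt x t + lambda1 \<gamma> (z x t) (w x t) * zx x t
             = (\<gamma> - 1) / 8 * a x * ((w x t)\<^sup>2 - (z x t)\<^sup>2) \<and>
           wt x t + lambda2 \<gamma> (z x t) (w x t) * wx x t
             = - ((\<gamma> - 1) / 8) * a x * ((w x t)\<^sup>2 - (z x t)\<^sup>2))) \<and>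
     (\<forall>x\<ge>0. z x 0 = z0 x \<and> w x 0 = w0 x) \<and>
     (\<forall>t\<in>{0..T}. z 0 t = zB t \<and> w 0 t = wB t)"

definition f_ratio :: "real \<Rightarrow> real \<Rightarrow> ereal" where
  "f_ratio \<gamma> r = (if r = 1 \<or> r = -1 then \<infinity>
     else ereal (2 / (\<gamma> - 1) * ((\<gamma> + 1 + (3 - \<gamma>) * r) / \<bar>r\<^sup>2 - 1\<bar>)))"

definition is_min_f :: "real \<Rightarrow> real \<Rightarrow> bool" where
  "is_min_f \<gamma> m \<longleftrightarrow>
     (\<exists>r\<in>{-1..1}. f_ratio \<gamma> r = ereal m) \<and> (\<forall>r\<in>{-1..1}. ereal m \<le> f_ratio \<gamma> r)"

definition l_const :: "real \<Rightarrow> real" where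
  "l_const \<gamma> = (THE m. is_min_f \<gamma> m)"

definition sigma2 :: "real \<Rightarrow> real" where
  "sigma2 \<gamma> = (THE r. 1 < r \<and> f_ratio \<gamma> r = ereal (l_const \<gamma>))"

definition Delta_region ::
  "(real \<Rightarrow> real) \<Rightarrow> real \<Rightarrow> real \<Rightarrow> real \<Rightarrow> real \<Rightarrow> real \<Rightarrow> (real \<times> real) set"
where
  "Delta_region abar L1 L2 U1 U2 x =
     {(z, w). L1 * exp (- integral {0..x} abar) \<le> z \<and> z \<le> U1 * exp (integral {0..x} abar) \<and>
              L2 * exp (- integral {0..x} abar) \<le> w \<and> w \<le> U2 * exp (integral {0..x} abar) \<and>
              z \<le> w}"

text \<open>
  The definite descriptions defining the two constants denote: the minimum exists and is positive,
  and the equation for the second constant has exactly one root above 1.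
\<close>

lemma f_ratio_min:
  assumes g: "1 < \<gamma>" "\<gamma> < 3"
  shows "\<exists>m>0. is_min_f \<gamma> m"
proof -
  define p q s m r where "p = \<gamma> + 1" and "q = 3 - \<gamma>" and "s = sqrt (p\<^sup>2 - q\<^sup>2)"
    and "m = (p + s) / 2" and "r = - q / (2 * m)"
  have pq: "0 < q" "q < p" using g by (auto simp: p_def q_def)
  have pos: "0 < p\<^sup>2 - q\<^sup>2" using pq by (simp add: power_strict_mono)
  have s: "0 < s" "s\<^sup>2 = p\<^sup>2 - q\<^sup>2" using pos by (auto simp: s_def)
  have m: "0 < m" "q < 2 * m"
    using s pq by (auto simp: m_def)
  have "4 * m * (p - m) = p\<^sup>2 - s\<^sup>2"
    by (simp add: m_def field_simps power2_eq_square)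
  then have mq: "q\<^sup>2 = 4 * m * (p - m)" using s(2) by simp
  have r: "-1 < r" "r < 0" using m pq by (auto simp: r_def field_simps)
  have sq: "p + q * y - m * (1 - y\<^sup>2) = m * (y - r)\<^sup>2" for y
  proof -
    have "m * (y - r)\<^sup>2 = m * y\<^sup>2 + q * y + q\<^sup>2 / (4 * m)"
      using m(1) unfolding r_def by (simp add: field_simps power2_eq_square)
    also have "q\<^sup>2 / (4 * m) = p - m" using m(1) mq by simp
    finally show ?thesis by (simp add: algebra_simps)
  qed
  have r2: "y\<^sup>2 < 1" if "-1 < y" "y < 1" for y :: real
    using that by (simp add: abs_square_less_1)
  have feq: "f_ratio \<gamma> y = ereal (2 / (\<gamma> - 1) * ((p + q * y) / (1 - y\<^sup>2)))"
    if "-1 < y" "y < 1" for y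
    using that r2[OF that] by (auto simp: f_ratio_def p_def q_def)
  have "p + q * r = m * (1 - r\<^sup>2)" using sq[of r] by simp
  then have "f_ratio \<gamma> r = ereal (2 / (\<gamma> - 1) * m)"
    using feq[of r] r r2[of r] by simp
  moreover have "ereal (2 / (\<gamma> - 1) * m) \<le> f_ratio \<gamma> y" if y: "y \<in> {-1..1}" for y
  proof (cases "y = 1 \<or> y = -1")
    case True
    then show ?thesis by (auto simp: f_ratio_def)
  next
    case False
    then have y': "-1 < y" "y < 1" using y by auto
    have "0 \<le> m * (y - r)\<^sup>2" using m by simp
    then have "m \<le> (p + q * y) / (1 - y\<^sup>2)"
      using sq[of y] r2[OF y'] by (simp add: pos_le_divide_eq)
    then show ?thesis unfolding feq[OF y'] ereal_less_eq(3)
      using g by (intro mult_left_mono) auto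
  qed
  ultimately have "is_min_f \<gamma> (2 / (\<gamma> - 1) * m)"
    unfolding is_min_f_def using r by force
  then show ?thesis using m g by (intro exI[of _ "2 / (\<gamma> - 1) * m"]) auto
qed

lemma is_min_f_unique: "is_min_f \<gamma> m \<Longrightarrow> is_min_f \<gamma> n \<Longrightarrow> m = n"
  unfolding is_min_f_def by (metis antisym ereal_less_eq(3))

lemma l_const:
  assumes "1 < \<gamma>" "\<gamma> < 3"
  shows "is_min_f \<gamma> (l_const \<gamma>)" "0 < l_const \<gamma>"
proof -
  obtain m where m: "0 < m" "is_min_f \<gamma> m" using f_ratio_min[OF assms] by blast
  have "l_const \<gamma> = m"
    unfolding l_const_def using m(2) is_min_f_unique[OF _ m(2)] by (rule the_equality)
  with m show "is_min_f \<gamma> (l_const \<gamma>)" "0 < l_const \<gamma>" by simp_all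
qed

lemma sigma2_ex1:
  assumes g: "1 < \<gamma>" "\<gamma> < 3" and c: "0 < c"
  shows "\<exists>!r. 1 < r \<and> f_ratio \<gamma> r = ereal c"
proof -
  define p q k d where "p = \<gamma> + 1" and "q = 3 - \<gamma>" and "k = c * (\<gamma> - 1) / 2"
    and "d = sqrt (q\<^sup>2 + 4 * k * (k + p))"
  have pos: "0 < p" "0 < q" "0 < k" using g c by (auto simp: p_def q_def k_def)
  have eq: "f_ratio \<gamma> r = ereal c \<longleftrightarrow> p + q * r = k * (r\<^sup>2 - 1)" if r: "1 < r" for r
  proof -
    have r2: "0 < r\<^sup>2 - 1" using r by (simp add: one_less_power)
    have val: "f_ratio \<gamma> r = ereal (2 / (\<gamma> - 1) * ((p + q * r) / (r\<^sup>2 - 1)))"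
      using r r2 by (simp add: f_ratio_def p_def q_def)
    have scale: "2 / (\<gamma> - 1) * Q = c \<longleftrightarrow> Q = k" for Q
      using g unfolding k_def by (auto simp: field_simps)
    have "f_ratio \<gamma> r = ereal c \<longleftrightarrow> (p + q * r) / (r\<^sup>2 - 1) = k"
      unfolding val ereal.inject by (rule scale)
    also have "\<dots> \<longleftrightarrow> p + q * r = k * (r\<^sup>2 - 1)"
      using r2 by (simp add: divide_eq_eq)
    finally show ?thesis .
  qed
  have dd: "0 \<le> d" "d\<^sup>2 = q\<^sup>2 + 4 * k * (k + p)" using pos by (auto simp: d_def)
  define r where "r = (q + d) / (2 * k)"
  have "4 * k * (k * (r\<^sup>2 - 1)) = 4 * k * (p + q * r)"
    using pos dd(2) unfolding r_def by (simp add: field_simps power2_eq_square)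
  then have root: "p + q * r = k * (r\<^sup>2 - 1)" using pos by simp
  have "2 * k - q < d"
  proof (rule power2_less_imp_less[OF _ dd(1)])
    show "(2 * k - q)\<^sup>2 < d\<^sup>2"
      using mult_pos_pos[OF pos(3,1)] mult_pos_pos[OF pos(3,2)]
      unfolding dd(2) by (simp add: power2_eq_square algebra_simps)
  qed
  then have r1: "1 < r" using pos by (simp add: r_def field_simps)
  have unique: "y = r" if y: "1 < y" "p + q * y = k * (y\<^sup>2 - 1)" for y
  proof (rule ccontr)
    assume ne: "y \<noteq> r"
    have "(y - r) * q = (y - r) * (k * (y + r))"
      using y(2) root by (simp add: power2_eq_square algebra_simps)
    then have "q = k * (y + r)" using ne by simp
    then have "p + k + k * (y * r) = 0"
      using root by (simp add: power2_eq_square algebra_simps)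
    moreover have "0 < k * (y * r)" using pos y(1) r1 by simp
    ultimately show False using pos by linarith
  qed
  show ?thesis
  proof (rule ex1I[of _ r])
    show "1 < r \<and> f_ratio \<gamma> r = ereal c" using r1 root eq[OF r1] by blast
    show "y = r" if "1 < y \<and> f_ratio \<gamma> y = ereal c" for y
      using that eq[of y] unique[of y] by blast
  qed
qed

lemma sigma2:
  assumes "1 < \<gamma>" "\<gamma> < 3"
  shows "1 < sigma2 \<gamma>" "f_ratio \<gamma> (sigma2 \<gamma>) = ereal (l_const \<gamma>)"
  using theI'[OF sigma2_ex1[OF assms l_const(2)[OF assms]]] unfolding sigma2_def by auto

end

theory Submission
  imports Defs
begin

text \<open>
  On a backward cone whose slope dominates both characteristic speeds, consider the first time at
  which one of the four bounds is attained. There the bound is attained by \<open>v \<in> {z, w}\<close> with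
  \<open>0 < z \<le> w \<le> \<sigma>\<^sub>2 z\<close>, and the growth of the barrier along the characteristic, \<open>\<lambda> abar v\<close>,
  strictly dominates the source term, so the bound was already violated earlier on the
  characteristic. This needs data strictly inside the region, which is arranged by relaxing the
  four constants by factors \<open>e\<^bsup>\<plusminus>\<epsilon>\<^esup>\<close>. Since \<open>abar > 0\<close>, the integral of \<open>abar\<close> over the base of the cone
  is strictly less than the full integral, so the ratio condition survives for small \<open>\<epsilon>\<close>.
\<close>

lemma first_touching:
  fixes \<Phi> :: "(real \<times> real \<Rightarrow> real) set" and b c T :: real
  defines "K \<equiv> {(x, t). 0 \<le> x \<and> 0 \<le> t \<and> t \<le> T \<and> x + c * t \<le> b}"
  assumes c: "0 \<le> c" and fin: "finite \<Phi>"
    and cont: "\<And>\<phi>. \<phi> \<in> \<Phi> \<Longrightarrow> continuous_on K \<phi>"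
    and data: "\<And>\<phi> x t. \<phi> \<in> \<Phi> \<Longrightarrow> (x, t) \<in> K \<Longrightarrow> x = 0 \<or> t = 0 \<Longrightarrow> 0 < \<phi> (x, t)"
    and touch: "\<And>\<phi> x t. \<phi> \<in> \<Phi> \<Longrightarrow> (x, t) \<in> K \<Longrightarrow> \<forall>\<psi>\<in>\<Phi>. 0 \<le> \<psi> (x, t) \<Longrightarrow> \<phi> (x, t) = 0 \<Longrightarrow>
      \<exists>\<mu> D. \<bar>\<mu>\<bar> \<le> c \<and> (\<phi> has_derivative D) (at (x, t) within K) \<and> 0 < D (\<mu>, 1)"
    and \<phi>: "\<phi> \<in> \<Phi>" and p: "p \<in> K"
  shows "0 < \<phi> p"
proof (rule ccontr)
  assume neg: "\<not> 0 < \<phi> p"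
  have "x \<le> b" if "(x, t) \<in> K" for x t
  proof -
    have "0 \<le> c * t" using that c by (simp add: K_def)
    then show ?thesis using that by (simp add: K_def)
  qed
  then have "K \<subseteq> {0..b} \<times> {0..T}" by (auto simp: K_def)
  then have "bounded K"
    by (rule bounded_subset[rotated]) (intro bounded_Times bounded_closed_interval)
  moreover have "closed K"
    unfolding K_def case_prod_beta by (intro closed_Collect_conj closed_Collect_le continuous_intros)
  ultimately have "compact K" by (simp add: compact_eq_bounded_closed)
  define B where "B = (\<Union>\<psi>\<in>\<Phi>. {p \<in> K. \<psi> p \<le> 0})"
  have "closed {p \<in> K. \<psi> p \<le> 0}" if "\<psi> \<in> \<Phi>" for \<psi>
    using continuous_closed_preimage[OF cont[OF that] \<open>closed K\<close>, of "{..0}"]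
    by (simp add: vimage_def Int_def)
  then have "closed B" unfolding B_def using fin by (intro closed_UN) auto
  moreover have "B \<subseteq> K" by (auto simp: B_def)
  ultimately have "compact B" using \<open>compact K\<close> by (metis compact_Int_closed inf.absorb_iff2)
  moreover have "p \<in> B" using neg p unfolding B_def by (intro UN_I[OF \<phi>]) simp
  ultimately obtain q where "q \<in> B" "\<forall>q'\<in>B. snd q \<le> snd q'"
    using continuous_attains_inf[of B snd] continuous_on_snd[OF continuous_on_id] by (metis empty_iff)
  then obtain x t where xt: "(x, t) \<in> B" and first: "\<And>y s. (y, s) \<in> B \<Longrightarrow> t \<le> s"
    by (cases q) force
  have before: "0 < \<psi> (y, s)" if "\<psi> \<in> \<Phi>" "(y, s) \<in> K" "s < t" for \<psi> y s
    using that first[of y s] unfolding B_def by force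
  from xt obtain \<phi>0 where \<phi>0: "\<phi>0 \<in> \<Phi>" "(x, t) \<in> K" "\<phi>0 (x, t) \<le> 0" by (auto simp: B_def)
  then have pos: "0 < x" "0 < t" using data[OF \<phi>0(1,2)] by (fastforce simp: K_def)+
  have inK: "(x - \<mu> * h, t - h) \<in> K" if "\<bar>\<mu>\<bar> \<le> c" "0 \<le> h" "h \<le> t" "c * h \<le> x" for \<mu> h
  proof -
    have "\<bar>\<mu> * h\<bar> \<le> c * h" using that by (simp add: abs_mult mult_right_mono)
    then show ?thesis using \<phi>0(2) that by (auto simp: K_def algebra_simps)
  qed
  define d where "d = min t (x / (c + 1))"
  have d: "0 < d" using pos c by (simp add: d_def)
  have line: "(x - \<mu> * h, t - h) \<in> K" if "\<bar>\<mu>\<bar> \<le> c" "h \<in> {0..d}" for \<mu> h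
  proof (rule inK)
    have "(c + 1) * h \<le> x" using that c by (simp add: d_def field_simps)
    then show "c * h \<le> x" using that(2) by (simp add: algebra_simps)
  qed (use that in \<open>auto simp: d_def\<close>)
  have nonneg: "0 \<le> \<psi> (x, t)" if \<psi>: "\<psi> \<in> \<Phi>" for \<psi>
  proof -
    have "continuous_on {0..d} (\<lambda>h. \<psi> (x - 0 * h, t - h))"
      by (rule continuous_on_compose2[OF cont[OF \<psi>]])
        (use line[of 0] c in \<open>auto intro!: continuous_intros\<close>)
    then have "((\<lambda>h. \<psi> (x, t - h)) \<longlongrightarrow> \<psi> (x, t)) (at 0 within {0..d})"
      using d by (fastforce simp: continuous_on_def dest: bspec[of _ _ 0])
    then have "((\<lambda>h. \<psi> (x, t - h)) \<longlongrightarrow> \<psi> (x, t)) (at_right 0)"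
      using d by (simp add: at_within_Icc_at_right)
    moreover have "eventually (\<lambda>h. 0 \<le> \<psi> (x, t - h)) (at_right 0)"
      using eventually_at_right_real[OF d]
      by eventually_elim (use before[OF \<psi> line[of 0]] c in \<open>simp add: less_imp_le\<close>)
    ultimately show ?thesis by (intro tendsto_lowerbound) auto
  qed
  then have "\<phi>0 (x, t) = 0" using \<phi>0 by force
  then obtain \<mu> D where D: "\<bar>\<mu>\<bar> \<le> c" "(\<phi>0 has_derivative D) (at (x, t) within K)" "0 < D (\<mu>, 1)"
    using touch \<phi>0 nonneg by blast
  have "((\<lambda>h. \<phi>0 (x - \<mu> * h, t - h)) has_derivative (\<lambda>h. D (- \<mu> * h, - h))) (at 0 within {0..d})"
  proof (rule has_derivative_in_compose[where g = \<phi>0 and g' = D])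
    show "((\<lambda>h. (x - \<mu> * h, t - h)) has_derivative (\<lambda>h. (- \<mu> * h, - h))) (at 0 within {0..d})"
      by (auto intro!: derivative_eq_intros)
    show "(\<phi>0 has_derivative D)
        (at (x - \<mu> * 0, t - 0) within (\<lambda>h. (x - \<mu> * h, t - h)) ` {0..d})"
      using line[OF D(1)] by (auto intro: has_derivative_subset[OF D(2)])
  qed
  moreover have "D (- \<mu> * h, - h) = - D (\<mu>, 1) * h" for h
    using linear_cmul[OF has_derivative_linear[OF D(2)], of "- h" "(\<mu>, 1)"] by (simp add: mult.commute)
  ultimately have "((\<lambda>h. \<phi>0 (x - \<mu> * h, t - h)) has_real_derivative - D (\<mu>, 1)) (at 0 within {0..d})"
    by (auto intro: has_derivative_imp_has_field_derivative)
  from has_real_derivative_neg_dec_right[OF this] D(3) obtain e where e: "0 < e"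
    "\<And>h. 0 < h \<Longrightarrow> h \<in> {0..d} \<Longrightarrow> h < e \<Longrightarrow> \<phi>0 (x - \<mu> * h, t - h) < \<phi>0 (x, t)"
    by auto
  define h where "h = min d (e / 2)"
  have h: "0 < h" "h \<in> {0..d}" "h < e" using d e(1) by (auto simp: h_def)
  have "0 < \<phi>0 (x - \<mu> * h, t - h)"
    using before[OF \<phi>0(1) line[OF D(1) h(2)]] h(1) by simp
  then show False using e(2)[OF h] \<phi>0(3) by linarith
qed

text \<open>The sign \<open>s = 1\<close> encodes a lower bound for \<open>v\<close>, and \<open>s = -1\<close> an upper bound.\<close>

definition barrier :: "real \<Rightarrow> real \<Rightarrow> (real \<Rightarrow> real) \<Rightarrow> (real \<Rightarrow> real \<Rightarrow> real) \<Rightarrow> real \<times> real \<Rightarrow> real" where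
  "barrier s c E v = (\<lambda>(x, t). s * (v x t - c * exp (- (s * E x))))"

lemma has_derivative_barrier:
  assumes v: "((\<lambda>(y, r). v y r) has_derivative (\<lambda>(h, k). vx * h + vt * k)) (at (x, t) within K)"
    and E: "(E has_real_derivative e) (at x within fst ` K)"
  shows "(barrier s c E v has_derivative
    (\<lambda>(h, k). s * (vx * h + vt * k + c * (s * e) * exp (- (s * E x)) * h))) (at (x, t) within K)"
proof -
  have "((\<lambda>p. E (fst p)) has_derivative (\<lambda>h. e * fst h)) (at (x, t) within K)"
    using has_derivative_in_compose[OF has_derivative_fst[OF has_derivative_ident], of E "(*) e" "(x, t)" K] E
    by (simp add: has_field_derivative_def)
  with v show ?thesis
    unfolding barrier_def case_prod_beta
    by (auto intro!: derivative_eq_intros simp: fun_eq_iff algebra_simps)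
qed

lemma barrier_touch:
  assumes v: "((\<lambda>(y, r). v y r) has_derivative (\<lambda>(h, k). vx * h + vt * k)) (at (x, t) within K)"
    and E: "(E has_real_derivative e) (at x within fst ` K)"
    and s: "s = 1 \<or> s = -1" and zero: "barrier s c E v (x, t) = 0"
    and source: "\<bar>vt + \<mu> * vx\<bar> < \<mu> * e * v x t"
  shows "\<exists>D. (barrier s c E v has_derivative D) (at (x, t) within K) \<and> 0 < D (\<mu>, 1)"
proof -
  have "v x t = c * exp (- (s * E x))" using zero s by (auto simp: barrier_def)
  with source have "\<bar>vt + \<mu> * vx\<bar> < c * e * exp (- (s * E x)) * \<mu>" by (simp add: mult_ac)
  then have "0 < s * (vx * \<mu> + vt * 1 + c * (s * e) * exp (- (s * E x)) * \<mu>)"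
    using s by (auto simp: algebra_simps)
  then show ?thesis using has_derivative_barrier[OF v E, of s c] by fastforce
qed

text \<open>The quadratic \<open>l (\<gamma> - 1) / 2 * (r\<^sup>2 - 1) - (\<gamma> + 1) - (3 - \<gamma>) r\<close> in \<open>r = w / z\<close> is negative at
  \<open>r = 1\<close> and vanishes at \<open>r = \<sigma>\<^sub>2\<close>.\<close>

lemma source_bound:
  assumes g: "1 < \<gamma>" "\<gamma> < 3" and z: "0 < z" "z \<le> w" "w \<le> sigma2 \<gamma> * z"
    and a: "\<bar>a\<bar> < l_const \<gamma> * e"
  shows "\<bar>(\<gamma> - 1) / 8 * a * (w\<^sup>2 - z\<^sup>2)\<bar> < lambda1 \<gamma> z w * e * z"
    and "\<bar>(\<gamma> - 1) / 8 * a * (w\<^sup>2 - z\<^sup>2)\<bar> < lambda2 \<gamma> z w * e * w"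
proof -
  define k p q \<sigma> where "k = l_const \<gamma> * (\<gamma> - 1) / 2" and "p = \<gamma> + 1" and "q = 3 - \<gamma>"
    and "\<sigma> = sigma2 \<gamma>"
  have l: "0 < l_const \<gamma>" using l_const(2)[OF g] .
  have e: "0 < e" using a l by (metis abs_ge_zero le_less_trans zero_less_mult_pos)
  have pos: "0 < k" "0 < p" "0 < q" "1 < \<sigma>"
    using g l sigma2(1)[OF g] by (auto simp: k_def p_def q_def \<sigma>_def)
  then have sigma: "0 < \<sigma>\<^sup>2 - 1" by (simp add: one_less_power)
  then have "l_const \<gamma> = 2 / (\<gamma> - 1) * ((p + q * \<sigma>) / (\<sigma>\<^sup>2 - 1))"
    using sigma2(2)[OF g] pos(4) by (simp add: f_ratio_def p_def q_def \<sigma>_def split: if_splits)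
  moreover have "2 / (\<gamma> - 1) * Q * (\<gamma> - 1) / 2 = Q" for Q
    using g by simp
  ultimately have "k = (p + q * \<sigma>) / (\<sigma>\<^sup>2 - 1)" unfolding k_def by metis
  then have root: "k * (\<sigma>\<^sup>2 - 1) = p + q * \<sigma>" using sigma by simp
  then have "\<sigma> * (k * \<sigma> - q) = p + k" by (simp add: algebra_simps power2_eq_square)
  then have "0 < k * \<sigma> - q"
    using pos by (metis add_pos_pos less_trans zero_less_one zero_less_mult_pos)
  then have "0 \<le> k * w + (k * \<sigma> - q) * z" using pos z by simp
  then have "0 \<le> (\<sigma> * z - w) * (k * w + (k * \<sigma> - q) * z)"
    using z by (intro mult_nonneg_nonneg) (auto simp: \<sigma>_def)
  also have "\<dots> = (k * (\<sigma>\<^sup>2 - 1) - q * \<sigma>) * z\<^sup>2 + k * z\<^sup>2 + q * w * z - k * w\<^sup>2"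
    by (simp add: algebra_simps power2_eq_square)
  also have "\<dots> = p * z\<^sup>2 + k * z\<^sup>2 + q * w * z - k * w\<^sup>2"
    unfolding root by simp
  finally have quad: "k * (w\<^sup>2 - z\<^sup>2) \<le> p * z\<^sup>2 + q * w * z"
    by (simp add: algebra_simps)
  have lam: "lambda1 \<gamma> z w * z = (p * z\<^sup>2 + q * w * z) / 4"
    "lambda2 \<gamma> z w * w = (p * w\<^sup>2 + q * w * z) / 4"
    by (simp_all add: lambda1_def lambda2_def p_def q_def power2_eq_square field_simps)
  have sq: "0 \<le> w\<^sup>2 - z\<^sup>2" using z by (simp add: power_mono)
  have abs: "\<bar>(\<gamma> - 1) / 8 * a * (w\<^sup>2 - z\<^sup>2)\<bar> = (\<gamma> - 1) / 8 * (w\<^sup>2 - z\<^sup>2) * \<bar>a\<bar>"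
    using g sq by (simp add: abs_mult)
  show 1: "\<bar>(\<gamma> - 1) / 8 * a * (w\<^sup>2 - z\<^sup>2)\<bar> < lambda1 \<gamma> z w * e * z"
  proof (cases "w = z")
    case True
    have "0 < lambda1 \<gamma> z w * z" unfolding lam using pos z by (simp add: add_pos_nonneg)
    then have "0 < lambda1 \<gamma> z w * z * e" using e by (rule mult_pos_pos)
    then show ?thesis using True by (simp add: mult_ac)
  next
    case False
    then have "0 < w\<^sup>2 - z\<^sup>2" using z by (simp add: power_strict_mono)
    then have "(\<gamma> - 1) / 8 * (w\<^sup>2 - z\<^sup>2) * \<bar>a\<bar> < (\<gamma> - 1) / 8 * (w\<^sup>2 - z\<^sup>2) * (l_const \<gamma> * e)"
      using a g by (intro mult_strict_left_mono) auto
    also have "\<dots> = k * (w\<^sup>2 - z\<^sup>2) * e / 4" by (simp add: k_def)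
    also have "\<dots> \<le> (p * z\<^sup>2 + q * w * z) * e / 4"
      using quad e by (simp add: mult_right_mono)
    also have "\<dots> = lambda1 \<gamma> z w * z * e" by (simp add: lam)
    finally show ?thesis unfolding abs by (simp add: mult_ac)
  qed
  have "lambda1 \<gamma> z w * z \<le> lambda2 \<gamma> z w * w"
    unfolding lam using sq pos by simp
  then have "lambda1 \<gamma> z w * e * z \<le> lambda2 \<gamma> z w * e * w"
    using e mult_left_mono[of "lambda1 \<gamma> z w * z" "lambda2 \<gamma> z w * w" e] by (simp add: mult_ac)
  with 1 show "\<bar>(\<gamma> - 1) / 8 * a * (w\<^sup>2 - z\<^sup>2)\<bar> < lambda2 \<gamma> z w * e * w" by linarith
qed

lemma barrier_relax:
  assumes "0 < c" "s = 1 \<or> s = -1" "0 < \<epsilon>" "0 \<le> barrier s c E v p"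
  shows "0 < barrier s c (\<lambda>x. E x + \<epsilon>) v p"
proof -
  obtain x t where p: "p = (x, t)" by (cases p)
  have "s * (c * exp (- (s * (E x + \<epsilon>)))) < s * (c * exp (- (s * E x)))"
    using assms(1-3) by auto
  then show ?thesis using assms(4) unfolding p barrier_def by (simp add: right_diff_distrib)
qed

lemma barrier_unrelax:
  assumes "0 < \<delta>" and pos: "\<And>\<epsilon>. 0 < \<epsilon> \<Longrightarrow> \<epsilon> < \<delta> \<Longrightarrow> 0 < barrier s c (\<lambda>x. E x + \<epsilon>) v p"
  shows "0 \<le> barrier s c E v p"
proof -
  obtain x t where p: "p = (x, t)" by (cases p)
  have "((\<lambda>\<epsilon>. s * (v x t - c * exp (- (s * (E x + \<epsilon>))))) \<longlongrightarrow>
      s * (v x t - c * exp (- (s * (E x + 0))))) (at_right 0)"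
    by (intro tendsto_intros)
  then have "((\<lambda>\<epsilon>. barrier s c (\<lambda>x. E x + \<epsilon>) v p) \<longlongrightarrow> barrier s c E v p) (at_right 0)"
    by (simp add: barrier_def p)
  moreover have "eventually (\<lambda>\<epsilon>. 0 \<le> barrier s c (\<lambda>x. E x + \<epsilon>) v p) (at_right 0)"
    using eventually_at_right_real[OF \<open>0 < \<delta>\<close>] by eventually_elim (use pos in force)
  ultimately show ?thesis by (intro tendsto_lowerbound) auto
qed

lemma Delta_region_iff_barrier:
  "(z x t, w x t) \<in> Delta_region abar L1 L2 U1 U2 x \<longleftrightarrow> z x t \<le> w x t \<and>
    (\<forall>(s, c, v)\<in>{(1, L1, z), (-1, U1, z), (1, L2, w), (-1, U2, w)}.
      0 \<le> barrier s c (\<lambda>x. integral {0..x} abar) v (x, t))"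
  by (auto simp: Delta_region_def barrier_def)

lemma lambda_bounds:
  assumes "1 < \<gamma>" "\<gamma> < 3" "\<bar>z\<bar> \<le> M" "\<bar>w\<bar> \<le> M"
  shows "\<bar>lambda1 \<gamma> z w\<bar> \<le> M" "\<bar>lambda2 \<gamma> z w\<bar> \<le> M"
proof -
  have *: "\<bar>p * u + q * v\<bar> \<le> M"
    if "0 \<le> p" "0 \<le> q" "p + q = 1" "\<bar>u\<bar> \<le> M" "\<bar>v\<bar> \<le> M" for p q u v :: real
  proof -
    have "\<bar>p * u + q * v\<bar> \<le> p * \<bar>u\<bar> + q * \<bar>v\<bar>"
      using that abs_triangle_ineq[of "p * u" "q * v"] by (simp add: abs_mult)
    also have "\<dots> \<le> M" using convex_bound_le[of "\<bar>u\<bar>" M "\<bar>v\<bar>" p q] that by simp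
    finally show ?thesis .
  qed
  show "\<bar>lambda1 \<gamma> z w\<bar> \<le> M" "\<bar>lambda2 \<gamma> z w\<bar> \<le> M"
    unfolding lambda1_def lambda2_def by (rule *; use assms in \<open>simp add: field_simps\<close>)+
qed

theorem proposition2p2:
  fixes \<gamma> L1 L2 U1 U2 T :: real
    and A a abar z0 w0 zB wB :: "real \<Rightarrow> real"
    and z w :: "real \<Rightarrow> real \<Rightarrow> real"
  assumes gamma: "1 < \<gamma>" "\<gamma> \<le> 5 / 3"
    and A: "Ck_on 2 {0..} A" "\<forall>x\<ge>0. A x > 0"
    and a: "\<forall>x\<ge>0. a x = deriv_on {0..} A x / A x"
    and abar: "C1_bounded_on {0..} abar" "abar absolutely_integrable_on {0..}"
    and consts_pos: "0 < L1" "0 < L2" "0 < U1" "0 < U2"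
    and a_less: "\<forall>x\<ge>0. \<bar>a x\<bar> < l_const \<gamma> * abar x"
    and L1_U1: "L1 \<le> U1"
    and L2_U2: "L2 \<le> U2"
    and no_vacuum: "L2 - U1 * exp (2 * integral {0..} abar) > 0"
    and ratio: "U2 / L1 * exp (2 * integral {0..} abar) \<le> sigma2 \<gamma>"
    and initial: "\<forall>x\<ge>0. (z0 x, w0 x) \<in> Delta_region abar L1 L2 U1 U2 x"
    and boundary: "\<forall>t\<ge>0. (zB t, wB t) \<in> Delta_region abar L1 L2 U1 U2 0"
    and T: "0 < T"
    and solution: "P2_solution \<gamma> a z0 w0 zB wB T z w"
    and rho_nonneg: "\<forall>x\<ge>0. \<forall>t\<in>{0..T}. z x t \<le> w x t"
  shows "\<forall>x\<ge>0. \<forall>t\<in>{0..T}. (z x t, w x t) \<in> Delta_region abar L1 L2 U1 U2 x"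
proof (intro allI ballI impI)
  fix x0 t0 :: real assume x0: "0 \<le> x0" and t0: "t0 \<in> {0..T}"
  have g3: "\<gamma> < 3" using gamma by simp
  have abar_pos: "0 < abar x" if "0 \<le> x" for x
    using a_less that l_const(2)[OF gamma(1) g3]
    by (metis abs_ge_zero le_less_trans zero_less_mult_pos)
  have abar_cont: "continuous_on {0..} abar"
    using abar(1) unfolding C1_bounded_on_def One_nat_def Ck_on.simps
    by (metis DERIV_continuous continuous_on_eq_continuous_within)
  obtain zx zt wx wt where
    diff: "C1_with_partials_on ({0..} \<times> {0..T}) z zx zt" "C1_with_partials_on ({0..} \<times> {0..T}) w wx wt"
    and eqs: "\<And>x t. 0 \<le> x \<Longrightarrow> t \<in> {0..T} \<Longrightarrow>
      zt x t + lambda1 \<gamma> (z x t) (w x t) * zx x t = (\<gamma> - 1) / 8 * a x * ((w x t)\<^sup>2 - (z x t)\<^sup>2)"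
      "\<And>x t. 0 \<le> x \<Longrightarrow> t \<in> {0..T} \<Longrightarrow>
      wt x t + lambda2 \<gamma> (z x t) (w x t) * wx x t = - ((\<gamma> - 1) / 8) * a x * ((w x t)\<^sup>2 - (z x t)\<^sup>2)"
    using solution unfolding P2_solution_def by blast
  have "bounded ((\<lambda>(x, t). z x t) ` ({0..} \<times> {0..T}) \<union> (\<lambda>(x, t). w x t) ` ({0..} \<times> {0..T}))"
    using solution unfolding P2_solution_def by simp
  then obtain M where M: "\<And>x t. 0 \<le> x \<Longrightarrow> t \<in> {0..T} \<Longrightarrow> \<bar>z x t\<bar> \<le> M \<and> \<bar>w x t\<bar> \<le> M"
    unfolding bounded_iff by (fastforce simp: image_iff)
  have M0: "0 \<le> M" using M[OF x0 t0] by linarith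
  define E where "E = (\<lambda>x. integral {0..x} abar)"
  define b where "b = x0 + M * t0"
  define K where "K = {(x, t). 0 \<le> x \<and> 0 \<le> t \<and> t \<le> T \<and> x + M * t \<le> b}"
  have K: "0 \<le> x \<and> x \<le> b \<and> t \<in> {0..T}" if "(x, t) \<in> K" for x t
  proof -
    have "0 \<le> M * t" using that M0 by (simp add: K_def)
    then show ?thesis using that by (simp add: K_def)
  qed
  have b0: "0 \<le> b" using x0 t0 M0 by (simp add: b_def)
  have cont: "continuous_on {c..d} abar" if "0 \<le> c" for c d
    using abar_cont by (rule continuous_on_subset) (use that in auto)
  have abar_int: "abar integrable_on {0..}"
    using abar(2) absolutely_integrable_on_def by blast
  have int: "abar integrable_on {0..d}" for d
    using cont[of 0 d] integrable_continuous_real by blast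
  have E_mono: "E x \<le> E y" if "x \<le> y" for x y
    unfolding E_def by (rule integral_subset_le) (use that int abar_pos in \<open>auto intro: less_imp_le\<close>)
  have "0 < integral {b..b + 1} abar"
    using integral_less_real[of b "b + 1" "\<lambda>_. 0" abar] cont[OF b0] abar_pos b0 by simp
  then have "E b < E (b + 1)"
    using Henstock_Kurzweil_Integration.integral_combine[of 0 b "b + 1" abar] b0 int
    by (simp add: E_def)
  also have "\<dots> \<le> integral {0..} abar"
    unfolding E_def by (rule integral_subset_le) (use int abar_int abar_pos in \<open>auto intro: less_imp_le\<close>)
  finally have gap: "0 < integral {0..} abar - E b" by simp
  define J :: "(real \<times> real \<times> (real \<Rightarrow> real \<Rightarrow> real)) set" where "J = {(1, L1, z), (-1, U1, z), (1, L2, w), (-1, U2, w)}"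
  have J: "(s = 1 \<or> s = -1) \<and> 0 < c" if "(s, c, v) \<in> J" for s c :: real and v
    using that consts_pos by (auto simp: J_def)
  have strict: "0 < barrier s c (\<lambda>x. E x + \<epsilon>) v (x0, t0)"
    if svc: "(s, c, v) \<in> J" and \<epsilon>: "0 < \<epsilon>" "\<epsilon> < integral {0..} abar - E b" for s c v and \<epsilon> :: real
  proof -
    define F where "F = (\<lambda>x. E x + \<epsilon>)"
    define \<Phi> where "\<Phi> = (\<lambda>(s, c, v). barrier s c F v) ` J"
    have F_deriv: "(F has_real_derivative abar x) (at x within fst ` K)" if "(x, t) \<in> K" for x t
    proof -
      have "(F has_real_derivative abar x) (at x within {0..b})"
        unfolding F_def E_def
        using integral_has_real_derivative[OF cont[of 0 b], of x] K[OF that]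
        by (auto intro!: derivative_eq_intros)
      then show ?thesis by (rule DERIV_subset) (use K in auto)
    qed
    have sub: "K \<subseteq> {0..} \<times> {0..T}" using K by auto
    have deriv: "((\<lambda>(y, r). v y r) has_derivative (\<lambda>(h, k). vx x t * h + vt x t * k)) (at (x, t) within K)"
      if "C1_with_partials_on ({0..} \<times> {0..T}) v vx vt" "(x, t) \<in> K" for v vx vt x t
      using that sub unfolding C1_with_partials_on_def
      by (auto intro!: has_derivative_subset[OF _ sub])
    have "0 < barrier s c F v (x0, t0)"
    proof (rule first_touching[of M \<Phi> T b, folded K_def])
      fix \<phi> assume "\<phi> \<in> \<Phi>"
      then obtain s c v where \<phi>: "\<phi> = barrier s c F v" and J': "(s, c, v) \<in> J"
        by (auto simp: \<Phi>_def)
      from J' have v: "v = z \<or> v = w" by (auto simp: J_def)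
      show "continuous_on K \<phi>"
        unfolding continuous_on_eq_continuous_within
      proof clarify
        fix x t assume xt: "(x, t) \<in> K"
        show "continuous (at (x, t) within K) \<phi>"
          using v has_derivative_continuous[OF has_derivative_barrier[OF deriv[OF diff(1) xt] F_deriv[OF xt]], of s c]
            has_derivative_continuous[OF has_derivative_barrier[OF deriv[OF diff(2) xt] F_deriv[OF xt]], of s c]
          unfolding \<phi> by blast
      qed
      show "0 < \<phi> (x, t)" if xt: "(x, t) \<in> K" and "x = 0 \<or> t = 0" for x t
      proof -
        have "(z x t, w x t) \<in> Delta_region abar L1 L2 U1 U2 x"
          using that(2)
        proof
          assume "x = 0"
          moreover have "z 0 t = zB t" "w 0 t = wB t" "0 \<le> t"
            using solution K[OF xt] unfolding P2_solution_def by auto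
          ultimately show ?thesis using boundary by simp
        next
          assume "t = 0"
          moreover have "z x 0 = z0 x" "w x 0 = w0 x" "0 \<le> x"
            using solution K[OF xt] unfolding P2_solution_def by auto
          ultimately show ?thesis using initial by simp
        qed
        then have "0 \<le> barrier s c E v (x, t)"
          using J' unfolding Delta_region_iff_barrier E_def[symmetric] J_def[symmetric] by blast
        then show ?thesis unfolding \<phi> F_def using J[OF J'] \<epsilon>(1) by (intro barrier_relax) auto
      qed
      show "\<exists>\<mu> D. \<bar>\<mu>\<bar> \<le> M \<and> (\<phi> has_derivative D) (at (x, t) within K) \<and> 0 < D (\<mu>, 1)"
        if xt: "(x, t) \<in> K" and nonneg: "\<forall>\<psi>\<in>\<Phi>. 0 \<le> \<psi> (x, t)" and zero: "\<phi> (x, t) = 0" for x t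
      proof -
        have x: "0 \<le> x" "t \<in> {0..T}" using K[OF xt] by auto
        have zw: "z x t \<le> w x t" using rho_nonneg x by blast
        have low: "L1 * exp (- F x) \<le> z x t" and up: "w x t \<le> U2 * exp (F x)"
          using nonneg unfolding \<Phi>_def J_def by (auto simp: barrier_def)
        have z_pos: "0 < z x t"
          using low consts_pos(1) by (meson exp_gt_zero less_le_trans mult_pos_pos)
        have "F x \<le> integral {0..} abar"
          using E_mono[of x b] K[OF xt] \<epsilon>(2) by (simp add: F_def)
        then have "U2 / L1 * exp (2 * F x) \<le> U2 / L1 * exp (2 * integral {0..} abar)"
          using consts_pos by (intro mult_left_mono) auto
        then have "U2 / L1 * exp (2 * F x) \<le> sigma2 \<gamma>" using ratio by linarith
        then have "U2 / L1 * exp (2 * F x) * (L1 * exp (- F x)) \<le> sigma2 \<gamma> * z x t"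
          using low consts_pos(1) sigma2(1)[OF gamma(1) g3] by (intro mult_mono) auto
        moreover have "U2 * exp (F x) = U2 / L1 * exp (2 * F x) * (L1 * exp (- F x))"
          using consts_pos(1) by (simp add: exp_minus exp_double power2_eq_square)
        ultimately have "w x t \<le> sigma2 \<gamma> * z x t" using up by linarith
        note src = source_bound[OF gamma(1) g3 z_pos zw this a_less[rule_format, OF x(1)]]
        note lam = lambda_bounds[OF gamma(1) g3, of "z x t" M "w x t"]
        from v show ?thesis
        proof
          assume v: "v = z"
          show ?thesis
            using barrier_touch[OF deriv[OF diff(1) xt] F_deriv[OF xt], of s c "lambda1 \<gamma> (z x t) (w x t)"]
              src(1) eqs(1)[OF x] lam(1) M[OF x] J[OF J'] zero unfolding \<phi> v by auto
        next
          assume v: "v = w"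
          show ?thesis
            using barrier_touch[OF deriv[OF diff(2) xt] F_deriv[OF xt], of s c "lambda2 \<gamma> (z x t) (w x t)"]
              src(2) eqs(2)[OF x] lam(2) M[OF x] J[OF J'] zero unfolding \<phi> v by auto
        qed
      qed
    next
      show "barrier s c F v \<in> \<Phi>" using svc by (force simp: \<Phi>_def)
      show "(x0, t0) \<in> K" using x0 t0 by (simp add: K_def b_def)
    qed (simp_all add: M0 \<Phi>_def J_def)
    then show ?thesis by (simp add: F_def)
  qed
  have "0 \<le> barrier s c E v (x0, t0)" if "(s, c, v) \<in> J" for s c v
    using barrier_unrelax[OF gap strict[OF that]] .
  then show "(z x0 t0, w x0 t0) \<in> Delta_region abar L1 L2 U1 U2 x0"
    using rho_nonneg x0 t0 unfolding Delta_region_iff_barrier E_def[symmetric] J_def[symmetric] by blast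
qed

end
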